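(* Let $X,Y$ be real Banach spaces and let $T:X\to Y$ be a bounded linear operator. Then $\Gamma_s(T^* )=\Gamma_s(T)$, where $T^*:Y^*\to X^*$ is the adjoint operator.
   Context: For a bounded subset $A$ of a Banach space $Z$, $\Gamma_s(A)$ is the infimum of the numbers $\varepsilon>0$ such that there are no arbitrarily long finite sequences $(z_k)_{k=1}^n\subset A$, $(z_k^* )_{k=1}^n\subset B_{Z^*}$ with $z_k^*(z_j)=0$ if $j<k$ and $z_k^*(z_j)>\varepsilon$ if $j\ge k$. ("There are no arbitrarily long sequences" means that for some $N\in\mathbb{N}$ there are no such sequences of length $n\geq N$.) For an operator $T:X\to Y$, $\Gamma_s(T):=\Gamma_s(T(B_X))$, computed in $Y$; likewise $\Gamma_s(T^* )=\Gamma_s(T^*(B_{Y^*}))$, computed in $X^*$. *)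

theory Defs
  imports "HOL-Analysis.Analysis"
begin

text \<open>The dual \<open>Z\<^sup>*\<close> of a real normed space \<open>Z\<close> is the type \<open>'z \<Rightarrow>\<^sub>L real\<close> of bounded
  functionals with the operator norm, and \<open>B\<^sub>Z\<close> is the closed unit ball \<open>cball 0 1\<close>.\<close>

text \<open>Only the values of \<open>z\<close> and \<open>zs\<close> on \<open>{1..n}\<close> matter.\<close>

definition triangular_system ::
    "'z::real_normed_vector set \<Rightarrow> real \<Rightarrow> nat \<Rightarrow> (nat \<Rightarrow> 'z) \<Rightarrow> (nat \<Rightarrow> 'z \<Rightarrow>\<^sub>L real) \<Rightarrow> bool" where
  "triangular_system A \<epsilon> n z zs \<longleftrightarrow>
     (\<forall>k\<in>{1..n}. z k \<in> A) \<and>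
     (\<forall>k\<in>{1..n}. zs k \<in> cball 0 1) \<and>
     (\<forall>k\<in>{1..n}. \<forall>j\<in>{1..n}.
        (j < k \<longrightarrow> blinfun_apply (zs k) (z j) = 0) \<and>
        (j \<ge> k \<longrightarrow> blinfun_apply (zs k) (z j) > \<epsilon>))"

text \<open>For bounded \<open>A\<close> the set below is nonempty and bounded below by \<open>0\<close>, so \<open>Inf\<close> is the
  actual infimum. For unbounded \<open>A\<close> the value has no meaning.\<close>

definition Gamma_s :: "'z::real_normed_vector set \<Rightarrow> real" where
  "Gamma_s A = Inf {\<epsilon>. \<epsilon> > 0 \<and> (\<exists>N::nat. \<forall>n\<ge>N. \<nexists>z zs. triangular_system A \<epsilon> n z zs)}"

definition Gamma_s_op :: "('x::real_normed_vector \<Rightarrow>\<^sub>L 'y::real_normed_vector) \<Rightarrow> real" where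
  "Gamma_s_op T = Gamma_s (blinfun_apply T ` cball 0 1)"

text \<open>The Banach space adjoint; the library's \<open>adjoint\<close> is the one for inner product spaces.\<close>

lift_definition dual_op ::
    "('x::real_normed_vector \<Rightarrow>\<^sub>L 'y::real_normed_vector) \<Rightarrow> ('y \<Rightarrow>\<^sub>L real) \<Rightarrow>\<^sub>L ('x \<Rightarrow>\<^sub>L real)"
  is "\<lambda>T f. f o\<^sub>L T"
  by (rule bounded_bilinear.bounded_linear_left[OF bounded_bilinear_blinfun_compose])

lemma Gamma_s_set_nonempty:
  fixes A :: "'z::real_normed_vector set"
  assumes "bounded A"
  shows "{\<epsilon>. \<epsilon> > 0 \<and> (\<exists>N::nat. \<forall>n\<ge>N. \<nexists>z zs. triangular_system A \<epsilon> n z zs)} \<noteq> {}"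
proof -
  obtain M where M: "M > 0" "\<And>a. a \<in> A \<Longrightarrow> norm a \<le> M"
    using assms bounded_pos by blast
  have False if n: "n \<ge> 1" and s: "triangular_system A M n z zs" for n z zs
  proof -
    have z: "norm (z 1) \<le> M" and f: "norm (zs 1) \<le> 1"
      and gt: "blinfun_apply (zs 1) (z 1) > M"
      using s n M(2) unfolding triangular_system_def by auto
    have "blinfun_apply (zs 1) (z 1) \<le> norm (zs 1) * norm (z 1)"
      using norm_blinfun[of "zs 1" "z 1"] by simp
    also have "\<dots> \<le> 1 * M"
      using z f by (intro mult_mono) auto
    finally show False using gt by simp
  qed
  then show ?thesis using M(1) by blast
qed

end

theory Submission
  imports Defs
begin

text \<open>A triangular system for \<open>T\<close> becomes one for \<open>T\<^sup>*\<close>, with the same \<open>\<epsilon>\<close> and the same length, by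
  reversing the order of both sequences and regarding points of \<open>X\<close> as functionals on \<open>X\<^sup>*\<close>. For the
  converse, Helly's lemma replaces the functionals in the ball of \<open>X\<^sup>*\<^sup>*\<close> by points of \<open>X\<close> of norm
  less than \<open>r\<close> with the same values on the finitely many \<open>T\<^sup>* y\<^sub>j\<^sup>*\<close>; here \<open>r > 1\<close> is arbitrary, and as the
  inequalities are strict and finite in number, they survive division by a suitable \<open>r\<close>.
  Helly's lemma is reduced to separation in the plane by intersecting the ball with one hyperplane
  after the other: the sections stay convex and algebraically relatively open.\<close>

section \<open>Algebraic openness and separation in finite dimension\<close>

text \<open>Relative openness without a topology: the segment from \<open>y\<close> to
  \<open>x\<close> continues past \<open>x\<close> inside \<open>C\<close>. In Euclidean space this
  matches the criterion \<open>convex_rel_interior_iff\<close>; it also survives hyperplane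
  sections, under which openness may be lost.\<close>

definition algebraically_open :: "'a::real_vector set \<Rightarrow> bool" where
  "algebraically_open C \<longleftrightarrow> (\<forall>x\<in>C. \<forall>y\<in>C. \<exists>e>1. (1 - e) *\<^sub>R y + e *\<^sub>R x \<in> C)"

lemma open_imp_algebraically_open:
  fixes C :: "'a::real_normed_vector set"
  assumes "open C"
  shows "algebraically_open C"
  unfolding algebraically_open_def
proof (intro ballI)
  fix x y assume x: "x \<in> C"
  have "((\<lambda>e. (1 - e) *\<^sub>R y + e *\<^sub>R x) \<longlongrightarrow> (1 - 1) *\<^sub>R y + 1 *\<^sub>R x) (at_right (1::real))"
    by (intro tendsto_intros)
  then have "\<forall>\<^sub>F e in at_right (1::real). (1 - e) *\<^sub>R y + e *\<^sub>R x \<in> C"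
    using x by (intro topological_tendstoD[OF _ assms]) auto
  moreover have "\<forall>\<^sub>F e in at_right (1::real). e > 1"
    by (rule eventually_at_right_less)
  ultimately have "\<forall>\<^sub>F e in at_right (1::real). (1 - e) *\<^sub>R y + e *\<^sub>R x \<in> C \<and> e > 1"
    by (rule eventually_conj)
  then show "\<exists>e>1. (1 - e) *\<^sub>R y + e *\<^sub>R x \<in> C"
    using eventually_happens'[OF trivial_limit_at_right_real] by blast
qed

lemma algebraically_open_section:
  assumes "algebraically_open C" and "linear h"
  shows "algebraically_open {x \<in> C. h x = (q::real)}"
  unfolding algebraically_open_def
proof (intro ballI)
  fix x y assume x: "x \<in> {x \<in> C. h x = q}" and y: "y \<in> {x \<in> C. h x = q}"
  then obtain e where "e > 1" "(1 - e) *\<^sub>R y + e *\<^sub>R x \<in> C"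
    using assms(1) unfolding algebraically_open_def by blast
  moreover have "h ((1 - e) *\<^sub>R y + e *\<^sub>R x) = (1 - e) * q + e * q"
    using x y by (simp add: linear_add[OF assms(2)] linear_cmul[OF assms(2)])
  then have "h ((1 - e) *\<^sub>R y + e *\<^sub>R x) = q"
    by (simp add: algebra_simps)
  ultimately show "\<exists>e>1. (1 - e) *\<^sub>R y + e *\<^sub>R x \<in> {x \<in> C. h x = q}"
    by blast
qed

lemma convex_section:
  assumes "convex C" and "linear h"
  shows "convex {x \<in> C. h x = (q::real)}"
proof -
  have "convex (h -` {q})"
    using assms(2) by (intro convex_linear_vimage) auto
  moreover have "{x \<in> C. h x = q} = C \<inter> h -` {q}" by auto
  ultimately show ?thesis using assms(1) by (simp add: convex_Int)
qed

text \<open>Linear maps carry prolonged segments to prolonged segments, and in a nonempty convex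
  subset of Euclidean space these characterise the points of the relative interior.\<close>

lemma rel_interior_linear_image_algebraically_open:
  fixes f :: "'a::real_vector \<Rightarrow> 'b::euclidean_space"
  assumes "convex C" and "algebraically_open C" and f: "linear f"
  shows "rel_interior (f ` C) = f ` C"
proof (cases "C = {}")
  case False
  have cv: "convex (f ` C)" using assms by (intro convex_linear_image)
  have "f x \<in> rel_interior (f ` C)" if "x \<in> C" for x
  proof -
    have "\<exists>e>1. (1 - e) *\<^sub>R z + e *\<^sub>R f x \<in> f ` C" if "z \<in> f ` C" for z
    proof -
      obtain y where y: "y \<in> C" "z = f y" using \<open>z \<in> f ` C\<close> by blast
      then obtain e where "e > 1" "(1 - e) *\<^sub>R y + e *\<^sub>R x \<in> C"
        using assms(2) \<open>x \<in> C\<close> unfolding algebraically_open_def by blast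
      moreover have "f ((1 - e) *\<^sub>R y + e *\<^sub>R x) = (1 - e) *\<^sub>R z + e *\<^sub>R f x"
        by (simp add: y linear_add[OF f] linear_cmul[OF f])
      ultimately show ?thesis by (metis imageI)
    qed
    then show ?thesis using convex_rel_interior_iff[OF cv] False by blast
  qed
  then show ?thesis using rel_interior_subset by blast
qed auto

text \<open>Strictness holds even for \<open>c\<close> in the closure: such a \<open>c\<close> lies
  on the relative frontier, and a supporting hyperplane there is strict on the relative interior,
  which is all of \<open>S\<close>.\<close>

lemma separating_hyperplane_rel_open_point:
  fixes S :: "'a::euclidean_space set"
  assumes "convex S" and "rel_interior S = S" and "c \<notin> S"
  shows "\<exists>a. \<forall>y\<in>S. a \<bullet> c < a \<bullet> y"
proof (cases "c \<in> closure S")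
  case True
  have "c \<notin> rel_interior S" using assms(2,3) by simp
  with assms(1) True show ?thesis
  proof (rule supporting_hyperplane_relative_frontier)
    fix a assume "\<And>y. y \<in> rel_interior S \<Longrightarrow> a \<bullet> c < a \<bullet> y"
    then have "\<forall>y\<in>S. a \<bullet> c < a \<bullet> y" unfolding assms(2) by (rule ballI)
    then show ?thesis by (rule exI)
  qed
next
  case False
  then obtain a b where "a \<bullet> c < b" and b: "\<forall>y\<in>closure S. b < a \<bullet> y"
    using separating_hyperplane_closed_point[OF convex_closure[OF assms(1)] closed_closure] by blast
  then have "a \<bullet> c < a \<bullet> y" if "y \<in> S" for y
    using b closure_subset[of S] that by force
  then show ?thesis by blast
qed

section \<open>Prescribed values of functionals on a convex set\<close>

text \<open>If the planar image of \<open>C\<close> missed \<open>(p, q)\<close>, separation would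
  give coefficients for which the combination of \<open>g\<close> and \<open>h\<close> stays
  strictly above its target on \<open>C\<close>, against \<open>att\<close>.\<close>

lemma two_functionals_attain:
  fixes g h :: "'a::real_vector \<Rightarrow> real"
  assumes C: "convex C" "algebraically_open C" and g: "linear g" and h: "linear h"
    and att: "\<And>\<alpha> \<beta>. \<exists>x\<in>C. \<alpha> * g x + \<beta> * h x = \<alpha> * p + \<beta> * q"
  shows "\<exists>x\<in>C. g x = p \<and> h x = q"
proof (rule ccontr)
  assume no: "\<not> ?thesis"
  define S where "S = (\<lambda>x. (g x, h x)) ` C"
  have lin: "linear (\<lambda>x. (g x, h x))"
    using g h by (auto intro!: linearI simp: linear_add linear_cmul)
  have cS: "convex S" unfolding S_def using C(1) lin by (intro convex_linear_image)
  have rS: "rel_interior S = S"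
    unfolding S_def using C lin by (intro rel_interior_linear_image_algebraically_open)
  have "(p, q) \<notin> S" using no by (auto simp: S_def)
  then obtain a where "\<forall>y\<in>S. a \<bullet> (p, q) < a \<bullet> y"
    using separating_hyperplane_rel_open_point[OF cS rS] by blast
  then have "\<forall>x\<in>C. fst a * p + snd a * q < fst a * g x + snd a * h x"
    by (simp add: S_def inner_prod_def)
  then show False using att[of "fst a" "snd a"] by force
qed

text \<open>Induction on \<open>I\<close> with \<open>C\<close> arbitrary, since prescribing the
  value of \<open>f j\<close> replaces \<open>C\<close> by a section. The hypothesis on combinations
  passes to the section by the planar case for a combination over \<open>I\<close> and
  \<open>f j\<close>.\<close>

lemma functionals_attain:
  fixes f :: "'i \<Rightarrow> 'a::real_vector \<Rightarrow> real"
  assumes "finite I" and "convex C" "algebraically_open C" and "\<And>i. i \<in> I \<Longrightarrow> linear (f i)"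
    and "\<And>a. \<exists>x\<in>C. (\<Sum>i\<in>I. a i * f i x) = (\<Sum>i\<in>I. a i * c i)"
  shows "\<exists>x\<in>C. \<forall>i\<in>I. f i x = c i"
  using assms
proof (induction I arbitrary: C rule: finite_induct)
  case empty
  then show ?case by auto
next
  case (insert j I)
  let ?C = "{x \<in> C. f j x = c j}"
  have lin: "linear (f i)" if "i \<in> insert j I" for i using insert.prems(3) that .
  have "\<exists>x\<in>?C. (\<Sum>i\<in>I. a i * f i x) = (\<Sum>i\<in>I. a i * c i)" for a
  proof -
    have "\<exists>x\<in>C. (\<Sum>i\<in>I. a i * f i x) = (\<Sum>i\<in>I. a i * c i) \<and> f j x = c j"
    proof (rule two_functionals_attain)
      show "linear (\<lambda>x. \<Sum>i\<in>I. a i * f i x)"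
        using lin by (auto intro!: linearI
          simp: linear_add linear_cmul sum.distrib sum_distrib_left algebra_simps)
      fix \<alpha> \<beta>
      \<comment> \<open>One coefficient family on \<open>insert j I\<close> encodes both terms of
        the planar combination; as \<open>j\<close> is not in \<open>I\<close>, the two cases do not
        interfere.\<close>
      let ?b = "\<lambda>i. if i = j then \<beta> else \<alpha> * a i"
      have *: "(\<Sum>i\<in>insert j I. ?b i * v i) = \<alpha> * (\<Sum>i\<in>I. a i * v i) + \<beta> * v j" for v :: "'i \<Rightarrow> real"
      proof -
        have "(\<Sum>i\<in>I. ?b i * v i) = (\<Sum>i\<in>I. \<alpha> * (a i * v i))"
          using insert.hyps by (intro sum.cong) auto
        then show ?thesis using insert.hyps by (simp add: sum_distrib_left)
      qed
      show "\<exists>x\<in>C. \<alpha> * (\<Sum>i\<in>I. a i * f i x) + \<beta> * f j x = \<alpha> * (\<Sum>i\<in>I. a i * c i) + \<beta> * c j"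
        using insert.prems(4)[of ?b] unfolding * .
    qed (use insert.prems lin in auto)
    then show ?thesis by blast
  qed
  then have "\<exists>x\<in>?C. \<forall>i\<in>I. f i x = c i"
    using insert.prems lin
    by (intro insert.IH convex_section algebraically_open_section) auto
  then show ?case by auto
qed

section \<open>Helly's lemma\<close>

text \<open>A functional may fail to attain its norm on the closed unit ball, hence the radius
  \<open>r > 1\<close>.\<close>

lemma blinfun_attains:
  fixes g :: "'a::real_normed_vector \<Rightarrow>\<^sub>L real"
  assumes "\<bar>v\<bar> \<le> norm g" and "r > 1"
  shows "\<exists>x\<in>ball 0 r. blinfun_apply g x = v"
proof (cases "g = 0")
  case True
  then show ?thesis using assms by (intro bexI[of _ 0]) auto
next
  case False
  \<comment> \<open>Being smaller than the operator norm, \<open>norm g / r\<close> is no bound for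
    \<open>g\<close>. A vector violating it is rescaled below to give the value
    \<open>v\<close>.\<close>
  then have "\<not> norm g \<le> norm g / r"
    using assms(2) by (simp add: field_simps)
  moreover have "0 \<le> norm g / r"
    using assms(2) by simp
  ultimately have "\<not> (\<forall>x. norm (blinfun_apply g x) \<le> norm g / r * norm x)"
    using norm_blinfun_bound[of "norm g / r" g] by blast
  then obtain x where x: "norm (blinfun_apply g x) > norm g / r * norm x"
    by (auto simp only: not_all not_le)
  have r: "r > 0" using assms(2) by simp
  have "0 \<le> norm g / r * norm x"
    using \<open>0 \<le> norm g / r\<close> by (rule mult_nonneg_nonneg) simp
  then have gx: "\<bar>blinfun_apply g x\<bar> > 0"
    using x unfolding real_norm_def by (rule le_less_trans)
  define y where "y = (v / blinfun_apply g x) *\<^sub>R x"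
  have "\<bar>v\<bar> * norm x \<le> norm g * norm x"
    using assms(1) by (intro mult_right_mono) auto
  also have "\<dots> = r * (norm g / r * norm x)"
    using r by simp
  also have "\<dots> < r * \<bar>blinfun_apply g x\<bar>"
    using x r unfolding real_norm_def by (rule mult_strict_left_mono)
  finally have "\<bar>v\<bar> * norm x / \<bar>blinfun_apply g x\<bar> < r"
    using gx by (simp only: pos_divide_less_eq)
  then have "norm y < r"
    by (simp add: y_def)
  moreover have "blinfun_apply g y = v"
    using gx by (simp add: y_def blinfun.scaleR_right)
  ultimately show ?thesis by auto
qed

text \<open>Since \<open>norm \<phi> \<le> 1\<close>, the value of \<open>\<phi>\<close> at a
  combination of the \<open>f i\<close> is at most its norm in modulus, so that single combination
  attains it on the ball; \<open>functionals_attain\<close> then makes the point common to all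
  \<open>i\<close>.\<close>

lemma Helly_lemma:
  fixes f :: "'i \<Rightarrow> 'a::real_normed_vector \<Rightarrow>\<^sub>L real" and \<phi> :: "('a \<Rightarrow>\<^sub>L real) \<Rightarrow>\<^sub>L real"
  assumes "finite I" and "norm \<phi> \<le> 1" and "r > 1"
  shows "\<exists>x\<in>ball 0 r. \<forall>i\<in>I. blinfun_apply (f i) x = blinfun_apply \<phi> (f i)"
proof (rule functionals_attain[OF \<open>finite I\<close>])
  show "linear (blinfun_apply (f i))" for i
    by (rule bounded_linear.linear[OF blinfun.bounded_linear_right])
  fix a :: "'i \<Rightarrow> real"
  let ?g = "\<Sum>i\<in>I. a i *\<^sub>R f i"
  have "\<bar>blinfun_apply \<phi> ?g\<bar> \<le> norm \<phi> * norm ?g"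
    using norm_blinfun[of \<phi> ?g] by simp
  also have "\<dots> \<le> norm ?g"
    using assms(2) by (simp add: mult_left_le_one_le)
  finally obtain x where "x \<in> ball 0 r" "blinfun_apply ?g x = blinfun_apply \<phi> ?g"
    using blinfun_attains assms(3) by blast
  then show "\<exists>x\<in>ball 0 r. (\<Sum>i\<in>I. a i * blinfun_apply (f i) x) = (\<Sum>i\<in>I. a i * blinfun_apply \<phi> (f i))"
    by (auto simp: blinfun.sum_left blinfun.sum_right blinfun.scaleR_left blinfun.scaleR_right)
qed (auto intro: open_imp_algebraically_open)

section \<open>Passage between an operator and its adjoint\<close>

lemma dual_op_apply: "blinfun_apply (blinfun_apply (dual_op T) g) x = blinfun_apply g (blinfun_apply T x)"
  by (simp add: dual_op.rep_eq)

text \<open>The canonical embedding into the bidual.\<close>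

lift_definition evaluation :: "'a::real_normed_vector \<Rightarrow> ('a \<Rightarrow>\<^sub>L real) \<Rightarrow>\<^sub>L real"
  is "\<lambda>x g. blinfun_apply g x"
  by (rule blinfun.bounded_linear_left)

lemma norm_evaluation_le: "norm (evaluation x) \<le> norm x"
proof (rule norm_blinfun_bound)
  show "norm (blinfun_apply (evaluation x) g) \<le> norm x * norm g" for g
    using norm_blinfun[of g x] by (simp add: evaluation.rep_eq mult.commute)
qed simp

text \<open>Exchanging points and functionals transposes the matrix of pairings; reversing the order
  of the indices restores its triangular shape.\<close>

lemma triangular_system_dual_op:
  fixes T :: "'x::real_normed_vector \<Rightarrow>\<^sub>L 'y::real_normed_vector"
  assumes "triangular_system (blinfun_apply T ` cball 0 1) \<epsilon> n z zs"
  shows "\<exists>w ws. triangular_system (blinfun_apply (dual_op T) ` cball 0 1) \<epsilon> n w ws"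
proof -
  have "\<forall>k\<in>{1..n}. \<exists>x\<in>cball 0 1. z k = blinfun_apply T x"
    using assms unfolding triangular_system_def by blast
  then obtain x where x: "\<And>k. k \<in> {1..n} \<Longrightarrow> x k \<in> cball 0 1 \<and> z k = blinfun_apply T (x k)"
    by metis
  let ?w = "\<lambda>k. blinfun_apply (dual_op T) (zs (n + 1 - k))"
  let ?ws = "\<lambda>k. evaluation (x (n + 1 - k))"
  have mem: "n + 1 - k \<in> {1..n}" if "k \<in> {1..n}" for k
    using that by auto
  have val: "blinfun_apply (?ws k) (?w j) = blinfun_apply (zs (n + 1 - j)) (z (n + 1 - k))"
    if "k \<in> {1..n}" for j k
    using x[OF mem[OF that]] by (simp add: evaluation.rep_eq dual_op_apply)
  have "triangular_system (blinfun_apply (dual_op T) ` cball 0 1) \<epsilon> n ?w ?ws"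
    unfolding triangular_system_def
  proof (intro conjI ballI)
    fix k assume k: "k \<in> {1..n}"
    show "?w k \<in> blinfun_apply (dual_op T) ` cball 0 1"
      using assms mem[OF k] unfolding triangular_system_def by blast
    show "?ws k \<in> cball 0 1"
      using x[OF mem[OF k]] norm_evaluation_le[of "x (n + 1 - k)"] by auto
    fix j assume j: "j \<in> {1..n}"
    have "n + 1 - k < n + 1 - j \<longleftrightarrow> j < k" "n + 1 - j \<le> n + 1 - k \<longleftrightarrow> k \<le> j"
      using j k by auto
    then show "j < k \<longrightarrow> blinfun_apply (?ws k) (?w j) = 0" "k \<le> j \<longrightarrow> blinfun_apply (?ws k) (?w j) > \<epsilon>"
      using assms mem[OF k] mem[OF j] unfolding val[OF k] triangular_system_def by blast+
  qed
  then show ?thesis by blast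
qed

text \<open>As \<open>r\<close> decreases to 1, \<open>v / r\<close> tends to \<open>v\<close>, so
  each of the finitely many strict inequalities holds for \<open>r\<close> close to 1.\<close>

lemma finite_strict_lower_bound_divide:
  fixes V :: "real set"
  assumes "finite V" and "\<And>v. v \<in> V \<Longrightarrow> v > \<epsilon>"
  shows "\<exists>r>1. \<forall>v\<in>V. v / r > \<epsilon>"
proof -
  have "\<forall>\<^sub>F r in at_right 1. v / r > \<epsilon>" if "v \<in> V" for v
  proof (rule order_tendstoD(1))
    show "((\<lambda>r. v / r) \<longlongrightarrow> v / 1) (at_right 1)" by (intro tendsto_intros) auto
    show "\<epsilon> < v / 1" using assms(2)[OF that] by simp
  qed
  then have "\<forall>\<^sub>F r in at_right 1. \<forall>v\<in>V. v / r > \<epsilon>"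
    by (simp add: eventually_ball_finite assms(1))
  then have "\<forall>\<^sub>F r in at_right (1::real). r > 1 \<and> (\<forall>v\<in>V. v / r > \<epsilon>)"
    by (intro eventually_conj eventually_at_right_less)
  then show ?thesis
    using eventually_happens'[OF trivial_limit_at_right_real] by blast
qed

lemma triangular_system_of_dual_op:
  fixes T :: "'x::real_normed_vector \<Rightarrow>\<^sub>L 'y::real_normed_vector"
  assumes "triangular_system (blinfun_apply (dual_op T) ` cball 0 1) \<epsilon> n w ws"
  shows "\<exists>z zs. triangular_system (blinfun_apply T ` cball 0 1) \<epsilon> n z zs"
proof -
  have w: "\<forall>k\<in>{1..n}. \<exists>g\<in>cball 0 1. w k = blinfun_apply (dual_op T) g"
    and ws: "\<And>k. k \<in> {1..n} \<Longrightarrow> norm (ws k) \<le> 1"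
    and zero: "\<And>j k. j \<in> {1..n} \<Longrightarrow> k \<in> {1..n} \<Longrightarrow> j < k \<Longrightarrow> blinfun_apply (ws k) (w j) = 0"
    and gt: "\<And>j k. j \<in> {1..n} \<Longrightarrow> k \<in> {1..n} \<Longrightarrow> k \<le> j \<Longrightarrow> blinfun_apply (ws k) (w j) > \<epsilon>"
    using assms unfolding triangular_system_def by auto
  obtain g where g: "\<And>k. k \<in> {1..n} \<Longrightarrow> g k \<in> cball 0 1 \<and> w k = blinfun_apply (dual_op T) (g k)"
    using w by metis
  \<comment> \<open>Only the entries required to exceed \<epsilon> are collected; the vanishing ones
    are unaffected by division.\<close>
  define V where "V = (\<lambda>(j, k). blinfun_apply (ws k) (w j)) ` {(j, k). j \<in> {1..n} \<and> k \<in> {1..n} \<and> k \<le> j}"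
  have V: "blinfun_apply (ws k) (w j) \<in> V" if "j \<in> {1..n}" "k \<in> {1..n}" "k \<le> j" for j k
    unfolding V_def by (rule image_eqI[of _ _ "(j, k)"]) (use that in simp_all)
  have "finite {(j, k). j \<in> {1..n} \<and> k \<in> {1..n} \<and> k \<le> j}"
    by (rule finite_subset[of _ "{1..n} \<times> {1..n}"]) auto
  then have "finite V" unfolding V_def by (rule finite_imageI)
  moreover have "v > \<epsilon>" if "v \<in> V" for v using that gt by (auto simp: V_def)
  ultimately have "\<exists>r>1. \<forall>v\<in>V. v / r > \<epsilon>"
    by (rule finite_strict_lower_bound_divide)
  then obtain r where r: "r > 1" "\<forall>v\<in>V. v / r > \<epsilon>"
    by blast
  \<comment> \<open>Helly's lemma is applied to each \<open>ws k\<close> separately, always with the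
    whole family \<open>w\<close>.\<close>
  have "\<forall>k\<in>{1..n}. \<exists>x\<in>ball 0 r. \<forall>j\<in>{1..n}. blinfun_apply (w j) x = blinfun_apply (ws k) (w j)"
    using Helly_lemma[OF finite_atLeastAtMost ws r(1)] by (intro ballI)
  then obtain x where x: "\<And>k. k \<in> {1..n} \<Longrightarrow> x k \<in> ball 0 r"
    and xw: "\<And>j k. k \<in> {1..n} \<Longrightarrow> j \<in> {1..n} \<Longrightarrow> blinfun_apply (w j) (x k) = blinfun_apply (ws k) (w j)"
    by metis
  \<comment> \<open>Division by \<open>r\<close> brings the points into the unit ball and costs the
    factor \<open>1 / r\<close> in every pairing, which the choice of \<open>r\<close> allows
    for.\<close>
  let ?z = "\<lambda>k. blinfun_apply T (x (n + 1 - k) /\<^sub>R r)"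
  let ?zs = "\<lambda>k. g (n + 1 - k)"
  have mem: "n + 1 - k \<in> {1..n}" if "k \<in> {1..n}" for k
    using that by auto
  have val: "blinfun_apply (?zs k) (?z j) = blinfun_apply (ws (n + 1 - j)) (w (n + 1 - k)) / r"
    if "j \<in> {1..n}" "k \<in> {1..n}" for j k
  proof -
    have "blinfun_apply (?zs k) (?z j) = blinfun_apply (w (n + 1 - k)) (x (n + 1 - j)) / r"
      using g[OF mem[OF that(2)]]
      by (simp add: dual_op_apply blinfun.scaleR_right divide_inverse mult.commute)
    then show ?thesis using xw[OF mem[OF that(1)] mem[OF that(2)]] by simp
  qed
  have "triangular_system (blinfun_apply T ` cball 0 1) \<epsilon> n ?z ?zs"
    unfolding triangular_system_def
  proof (intro conjI ballI impI)
    fix k assume k: "k \<in> {1..n}"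
    have "x (n + 1 - k) /\<^sub>R r \<in> cball 0 1"
      using x[OF mem[OF k]] r(1) by (simp add: field_simps)
    then show "?z k \<in> blinfun_apply T ` cball 0 1" by (rule imageI)
    show "?zs k \<in> cball 0 1" using g[OF mem[OF k]] by blast
    fix j assume j: "j \<in> {1..n}"
    show "blinfun_apply (?zs k) (?z j) = 0" if "j < k"
    proof -
      have "n + 1 - k < n + 1 - j" using that j k by auto
      then show ?thesis unfolding val[OF j k] using zero[OF mem[OF k] mem[OF j]] by simp
    qed
    show "blinfun_apply (?zs k) (?z j) > \<epsilon>" if "k \<le> j"
    proof -
      have "n + 1 - j \<le> n + 1 - k" using that by auto
      then have "blinfun_apply (ws (n + 1 - j)) (w (n + 1 - k)) \<in> V"
        by (rule V[OF mem[OF k] mem[OF j]])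
      then show ?thesis unfolding val[OF j k] by (rule r(2)[rule_format])
    qed
  qed
  then show ?thesis by blast
qed

theorem theorem4p2:
  fixes T :: "'x::banach \<Rightarrow>\<^sub>L 'y::banach"
  shows "Gamma_s_op (dual_op T) = Gamma_s_op T"
proof -
  \<comment> \<open>Since \<epsilon> and \<open>n\<close> are preserved both ways, the two infima
    are taken over the same set.\<close>
  have "(\<exists>z zs. triangular_system (blinfun_apply (dual_op T) ` cball 0 1) \<epsilon> n z zs) \<longleftrightarrow>
      (\<exists>z zs. triangular_system (blinfun_apply T ` cball 0 1) \<epsilon> n z zs)" for \<epsilon> n
    using triangular_system_dual_op triangular_system_of_dual_op by blast
  then show ?thesis by (simp add: Gamma_s_op_def Gamma_s_def)
qed

end
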